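(* Let $k$ be an algebraically closed field of characteristic $0$ and let $R=k\langle x,y\rangle/(xy-yx-y^2)$. For all $\alpha,\beta\in k$ with $\alpha\neq\beta$ one has $\mathrm{Ext}^1_R(S_\alpha,S_\beta)=0$.
   Context: For $\alpha\in k$, $S_\alpha=(\alpha,0)$ denotes the one-dimensional $R$-module $k$ on which $x$ acts as multiplication by $\alpha$ and $y$ acts as $0$. *)

theory Defs
  imports
    "HOL-Library.Poly_Mapping"
    "HOL-Computational_Algebra.Polynomial"
    "HOL-Algebra.QuotRing"
    "HOL-Algebra.Module"
    "HOL-Algebra.Elementary_Groups"
    "HOL-Algebra.Algebraic_Closure_Type"
begin

section \<open>Left modules over a not necessarily commutative ring\<close>

text \<open>
  The locale \<^locale>\<open>module\<close> requires a commutative ring of scalars.  We keep its record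
  type; the fields for multiplication and unit of the module are irrelevant.
\<close>

locale left_module = R?: ring R + M?: abelian_group M
  for R :: "('a, 'c) ring_scheme" (structure) and M :: "('a, 'b, 'd) module_scheme" (structure) +
  assumes smult_closed [simp, intro]:
      "\<lbrakk>a \<in> carrier R; x \<in> carrier M\<rbrakk> \<Longrightarrow> a \<odot>\<^bsub>M\<^esub> x \<in> carrier M"
    and smult_l_distr:
      "\<lbrakk>a \<in> carrier R; b \<in> carrier R; x \<in> carrier M\<rbrakk> \<Longrightarrow>
        (a \<oplus> b) \<odot>\<^bsub>M\<^esub> x = a \<odot>\<^bsub>M\<^esub> x \<oplus>\<^bsub>M\<^esub> b \<odot>\<^bsub>M\<^esub> x"
    and smult_r_distr:
      "\<lbrakk>a \<in> carrier R; x \<in> carrier M; y \<in> carrier M\<rbrakk> \<Longrightarrow>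
        a \<odot>\<^bsub>M\<^esub> (x \<oplus>\<^bsub>M\<^esub> y) = a \<odot>\<^bsub>M\<^esub> x \<oplus>\<^bsub>M\<^esub> a \<odot>\<^bsub>M\<^esub> y"
    and smult_assoc:
      "\<lbrakk>a \<in> carrier R; b \<in> carrier R; x \<in> carrier M\<rbrakk> \<Longrightarrow>
        (a \<otimes> b) \<odot>\<^bsub>M\<^esub> x = a \<odot>\<^bsub>M\<^esub> (b \<odot>\<^bsub>M\<^esub> x)"
    and smult_one [simp]: "x \<in> carrier M \<Longrightarrow> \<one> \<odot>\<^bsub>M\<^esub> x = x"

text \<open>
  Homomorphisms are extensional functions, so that two of them are equal as soon as they agree
  on the carrier of the source.
\<close>

definition module_homs ::
  "('a, 'c) ring_scheme \<Rightarrow> ('a, 'm, 'd) module_scheme \<Rightarrow> ('a, 'n, 'e) module_scheme \<Rightarrow> ('m \<Rightarrow> 'n) set"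
  where "module_homs R M N =
    {f \<in> carrier M \<rightarrow>\<^sub>E carrier N.
      (\<forall>x\<in>carrier M. \<forall>y\<in>carrier M. f (x \<oplus>\<^bsub>M\<^esub> y) = f x \<oplus>\<^bsub>N\<^esub> f y) \<and>
      (\<forall>a\<in>carrier R. \<forall>x\<in>carrier M. f (a \<odot>\<^bsub>M\<^esub> x) = a \<odot>\<^bsub>N\<^esub> f x)}"

definition Hom_group ::
  "('a, 'c) ring_scheme \<Rightarrow> ('a, 'm, 'd) module_scheme \<Rightarrow> ('a, 'n, 'e) module_scheme \<Rightarrow> ('m \<Rightarrow> 'n) monoid"
  where "Hom_group R M N =
    \<lparr>carrier = module_homs R M N,
     monoid.mult = (\<lambda>f g. \<lambda>x\<in>carrier M. f x \<oplus>\<^bsub>N\<^esub> g x),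
     monoid.one = (\<lambda>x\<in>carrier M. \<zero>\<^bsub>N\<^esub>)\<rparr>"


section \<open>The standard free resolution and \<open>Ext\<^sup>1\<close>\<close>

definition free_module :: "('a, 'c) ring_scheme \<Rightarrow> 'x set \<Rightarrow> ('a, 'x \<Rightarrow> 'a) module"
  where "free_module R A =
    \<lparr>carrier = {f. (\<forall>x. f x \<in> carrier R) \<and> (\<forall>x. x \<notin> A \<longrightarrow> f x = \<zero>\<^bsub>R\<^esub>) \<and>
                   finite {x. f x \<noteq> \<zero>\<^bsub>R\<^esub>}},
     monoid.mult = undefined, monoid.one = undefined,
     ring.zero = (\<lambda>x. \<zero>\<^bsub>R\<^esub>), ring.add = (\<lambda>f g x. f x \<oplus>\<^bsub>R\<^esub> g x),
     module.smult = (\<lambda>a f x. a \<otimes>\<^bsub>R\<^esub> f x)\<rparr>"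

text \<open>
  The \<open>R\<close>-linear map \<open>\<Sum> a\<^sub>x [x] \<mapsto> \<Sum> a\<^sub>x x\<close> from a free module on elements of \<open>M\<close> to \<open>M\<close>.
\<close>

definition free_eval ::
  "('a, 'c) ring_scheme \<Rightarrow> ('a, 'm, 'd) module_scheme \<Rightarrow> ('m \<Rightarrow> 'a) \<Rightarrow> 'm"
  where "free_eval R M f = (\<Oplus>\<^bsub>M\<^esub>x\<in>{x. f x \<noteq> \<zero>\<^bsub>R\<^esub>}. f x \<odot>\<^bsub>M\<^esub> x)"

lemma free_module_left_module:
  assumes "ring R"
  shows "left_module R (free_module R A)"
proof -
  interpret R: ring R by fact
  have fin_add: "finite {x. f x \<oplus>\<^bsub>R\<^esub> g x \<noteq> \<zero>\<^bsub>R\<^esub>}"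
    if "finite {x. f x \<noteq> \<zero>\<^bsub>R\<^esub>}" "finite {x. g x \<noteq> \<zero>\<^bsub>R\<^esub>}" for f g :: "'c \<Rightarrow> 'a"
    by (rule finite_subset[OF _ finite_UnI[OF that]]) auto
  have fin_smult: "finite {x. a \<otimes>\<^bsub>R\<^esub> f x \<noteq> \<zero>\<^bsub>R\<^esub>}"
    if "finite {x. f x \<noteq> \<zero>\<^bsub>R\<^esub>}" "a \<in> carrier R" for f :: "'c \<Rightarrow> 'a" and a
    by (rule finite_subset[OF _ that(1)]) (use that(2) in auto)
  have "abelian_group (free_module R A)"
  proof (rule abelian_groupI)
    fix f assume f: "f \<in> carrier (free_module R A)"
    show "\<exists>g\<in>carrier (free_module R A). g \<oplus>\<^bsub>free_module R A\<^esub> f = \<zero>\<^bsub>free_module R A\<^esub>"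
    proof (rule bexI)
      show "(\<lambda>x. \<ominus>\<^bsub>R\<^esub> f x) \<oplus>\<^bsub>free_module R A\<^esub> f = \<zero>\<^bsub>free_module R A\<^esub>"
        using f by (auto simp: free_module_def R.l_neg)
      have "finite {x. \<ominus>\<^bsub>R\<^esub> f x \<noteq> \<zero>\<^bsub>R\<^esub>}"
        by (rule finite_subset[of _ "{x. f x \<noteq> \<zero>\<^bsub>R\<^esub>}"]) (use f in \<open>auto simp: free_module_def\<close>)
      then show "(\<lambda>x. \<ominus>\<^bsub>R\<^esub> f x) \<in> carrier (free_module R A)"
        using f by (auto simp: free_module_def)
    qed
  qed (auto simp: free_module_def fin_add R.a_ac)
  then show ?thesis
    by (auto simp: left_module_def left_module_axioms_def assms free_module_def fin_smult
        R.l_distr R.r_distr R.m_assoc)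
qed

lemma (in left_module) free_eval_superset:
  assumes f: "f \<in> carrier (free_module R A)" and A: "A \<subseteq> carrier M"
    and B: "finite B" "{x. f x \<noteq> \<zero>} \<subseteq> B" "B \<subseteq> carrier M"
  shows "free_eval R M f = (\<Oplus>\<^bsub>M\<^esub>x\<in>B. f x \<odot>\<^bsub>M\<^esub> x)"
proof -
  have z: "\<zero> \<odot>\<^bsub>M\<^esub> x = \<zero>\<^bsub>M\<^esub>" if "x \<in> carrier M" for x
    using smult_l_distr[of \<zero> \<zero> x] that
    by (metis M.add.l_cancel_one' R.r_zero R.zero_closed smult_closed)
  have "f x \<in> carrier R" for x
    using f by (simp add: free_module_def)
  then show ?thesis
    unfolding free_eval_def using B z
    by (intro M.add.finprod_mono_neutral_cong_left) (auto simp: subset_iff)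
qed

lemma (in left_module) free_eval_hom:
  assumes A: "A \<subseteq> carrier M"
  shows "restrict (free_eval R M) (carrier (free_module R A)) \<in> module_homs R (free_module R A) M"
proof -
  interpret F: left_module R "free_module R A"
    by (rule free_module_left_module) (rule R.ring_axioms)
  have car: "f x \<in> carrier R" if "f \<in> carrier (free_module R A)" for f x
    using that by (simp add: free_module_def)
  have sup: "{x. f x \<noteq> \<zero>} \<subseteq> carrier M" "finite {x. f x \<noteq> \<zero>}"
    if "f \<in> carrier (free_module R A)" for f
    using that A by (auto simp: free_module_def)
  have cl: "free_eval R M f \<in> carrier M" if f: "f \<in> carrier (free_module R A)" for f
    unfolding free_eval_def using sup[OF f] car[OF f] by (intro M.finsum_closed) auto
  have add: "free_eval R M (f \<oplus>\<^bsub>free_module R A\<^esub> g) = free_eval R M f \<oplus>\<^bsub>M\<^esub> free_eval R M g"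
    if f: "f \<in> carrier (free_module R A)" and g: "g \<in> carrier (free_module R A)" for f g
  proof -
    let ?B = "{x. f x \<noteq> \<zero>} \<union> {x. g x \<noteq> \<zero>}"
    have B: "finite ?B" "?B \<subseteq> carrier M"
      using sup[OF f] sup[OF g] by auto
    have "free_eval R M (f \<oplus>\<^bsub>free_module R A\<^esub> g)
        = (\<Oplus>\<^bsub>M\<^esub>x\<in>?B. (f \<oplus>\<^bsub>free_module R A\<^esub> g) x \<odot>\<^bsub>M\<^esub> x)"
      by (rule free_eval_superset[OF F.a_closed[OF f g] A B(1) _ B(2)])
        (auto simp: free_module_def)
    also have "\<dots> = (\<Oplus>\<^bsub>M\<^esub>x\<in>?B. f x \<odot>\<^bsub>M\<^esub> x \<oplus>\<^bsub>M\<^esub> g x \<odot>\<^bsub>M\<^esub> x)"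
      using B car[OF f] car[OF g]
      by (intro M.finsum_cong') (auto simp: free_module_def subset_iff intro!: smult_l_distr)
    also have "\<dots> = (\<Oplus>\<^bsub>M\<^esub>x\<in>?B. f x \<odot>\<^bsub>M\<^esub> x) \<oplus>\<^bsub>M\<^esub> (\<Oplus>\<^bsub>M\<^esub>x\<in>?B. g x \<odot>\<^bsub>M\<^esub> x)"
      using B car[OF f] car[OF g] by (intro M.finsum_addf) auto
    also have "(\<Oplus>\<^bsub>M\<^esub>x\<in>?B. f x \<odot>\<^bsub>M\<^esub> x) = free_eval R M f"
      by (rule free_eval_superset[OF f A B(1) _ B(2), symmetric]) auto
    also have "(\<Oplus>\<^bsub>M\<^esub>x\<in>?B. g x \<odot>\<^bsub>M\<^esub> x) = free_eval R M g"
      by (rule free_eval_superset[OF g A B(1) _ B(2), symmetric]) auto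
    finally show ?thesis .
  qed
  have smult_sum: "a \<odot>\<^bsub>M\<^esub> (\<Oplus>\<^bsub>M\<^esub>x\<in>B. h x) = (\<Oplus>\<^bsub>M\<^esub>x\<in>B. a \<odot>\<^bsub>M\<^esub> h x)"
    if "finite B" "a \<in> carrier R" "h \<in> B \<rightarrow> carrier M" for a B and h :: "'b \<Rightarrow> 'b"
    using that(1,3)
  proof (induction B rule: finite_induct)
    case empty
    have "a \<odot>\<^bsub>M\<^esub> \<zero>\<^bsub>M\<^esub> = \<zero>\<^bsub>M\<^esub>"
      using smult_r_distr[of a "\<zero>\<^bsub>M\<^esub>" "\<zero>\<^bsub>M\<^esub>"] that(2)
      by (metis M.add.l_cancel_one' M.r_zero M.zero_closed smult_closed)
    then show ?case by simp
  next
    case (insert x B)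
    then have "h \<in> B \<rightarrow> carrier M" "h x \<in> carrier M" by auto
    moreover from this have "(\<lambda>x. a \<odot>\<^bsub>M\<^esub> h x) \<in> B \<rightarrow> carrier M" "a \<odot>\<^bsub>M\<^esub> h x \<in> carrier M"
      using that(2) by auto
    ultimately show ?case
      using insert that(2) by (simp add: smult_r_distr)
  qed
  have smult: "free_eval R M (a \<odot>\<^bsub>free_module R A\<^esub> f) = a \<odot>\<^bsub>M\<^esub> free_eval R M f"
    if a: "a \<in> carrier R" and f: "f \<in> carrier (free_module R A)" for a f
  proof -
    have "free_eval R M (a \<odot>\<^bsub>free_module R A\<^esub> f)
        = (\<Oplus>\<^bsub>M\<^esub>x\<in>{x. f x \<noteq> \<zero>}. (a \<odot>\<^bsub>free_module R A\<^esub> f) x \<odot>\<^bsub>M\<^esub> x)"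
      by (rule free_eval_superset[OF F.smult_closed[OF a f] A sup(2)[OF f] _ sup(1)[OF f]])
        (use a in \<open>auto simp: free_module_def\<close>)
    also have "\<dots> = (\<Oplus>\<^bsub>M\<^esub>x\<in>{x. f x \<noteq> \<zero>}. a \<odot>\<^bsub>M\<^esub> (f x \<odot>\<^bsub>M\<^esub> x))"
      using sup[OF f] car[OF f] a
      by (intro M.finsum_cong') (auto simp: free_module_def subset_iff intro!: smult_assoc)
    also have "\<dots> = a \<odot>\<^bsub>M\<^esub> free_eval R M f"
      unfolding free_eval_def
      by (rule smult_sum[symmetric]) (use sup[OF f] car[OF f] a in auto)
    finally show ?thesis .
  qed
  show ?thesis
    by (auto simp: module_homs_def cl add smult)
qed

lemma (in left_module) free_eval_image:
  assumes A: "A \<subseteq> carrier M" and "x \<in> A"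
  shows "x \<in> free_eval R M ` carrier (free_module R A)"
proof -
  let ?f = "\<lambda>z. if z = x then \<one> else \<zero>"
  have f: "?f \<in> carrier (free_module R A)"
    using assms by (auto simp: free_module_def intro!: finite_subset[of _ "{x}"])
  have "free_eval R M ?f = (\<Oplus>\<^bsub>M\<^esub>z\<in>{x}. ?f z \<odot>\<^bsub>M\<^esub> z)"
    by (rule free_eval_superset[OF f A]) (use assms in auto)
  also have "\<dots> = x"
    using assms by (auto simp: subset_iff)
  finally show ?thesis using f by (metis imageI)
qed

text \<open>
  The beginning \<open>P\<^sub>2 \<rightarrow> P\<^sub>1 \<rightarrow> P\<^sub>0 \<rightarrow> M \<rightarrow> 0\<close> of the standard free resolution: \<open>P\<^sub>0\<close> is free on the
  elements of \<open>M\<close>, and each further term is free on the elements of the preceding kernel.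
  All maps are instances of \<^const>\<open>free_eval\<close>.
\<close>

definition res0 :: "('a, 'c) ring_scheme \<Rightarrow> ('a, 'm, 'd) module_scheme \<Rightarrow> ('a, 'm \<Rightarrow> 'a) module"
  where "res0 R M = free_module R (carrier M)"

definition res1 ::
  "('a, 'c) ring_scheme \<Rightarrow> ('a, 'm, 'd) module_scheme \<Rightarrow> ('a, ('m \<Rightarrow> 'a) \<Rightarrow> 'a) module"
  where "res1 R M = free_module R (a_kernel (res0 R M) M (free_eval R M))"

definition res2 ::
  "('a, 'c) ring_scheme \<Rightarrow> ('a, 'm, 'd) module_scheme \<Rightarrow> ('a, (('m \<Rightarrow> 'a) \<Rightarrow> 'a) \<Rightarrow> 'a) module"
  where "res2 R M = free_module R (a_kernel (res1 R M) (res0 R M) (free_eval R (res0 R M)))"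

text \<open>
  \<open>Ext\<^sup>1(M, N)\<close> is the cohomology at the middle term of
  \<open>Hom(P\<^sub>0, N) \<rightarrow> Hom(P\<^sub>1, N) \<rightarrow> Hom(P\<^sub>2, N)\<close>.
\<close>

definition Ext1_cocycles ::
  "('a, 'c) ring_scheme \<Rightarrow> ('a, 'm, 'd) module_scheme \<Rightarrow> ('a, 'n, 'e) module_scheme \<Rightarrow>
    ((('m \<Rightarrow> 'a) \<Rightarrow> 'a) \<Rightarrow> 'n) set"
  where "Ext1_cocycles R M N =
    kernel (Hom_group R (res1 R M) N) (Hom_group R (res2 R M) N)
      (\<lambda>f. compose (carrier (res2 R M)) f (free_eval R (res1 R M)))"

definition Ext1_coboundaries ::
  "('a, 'c) ring_scheme \<Rightarrow> ('a, 'm, 'd) module_scheme \<Rightarrow> ('a, 'n, 'e) module_scheme \<Rightarrow>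
    ((('m \<Rightarrow> 'a) \<Rightarrow> 'a) \<Rightarrow> 'n) set"
  where "Ext1_coboundaries R M N =
    (\<lambda>g. compose (carrier (res1 R M)) g (free_eval R (res0 R M))) `
      carrier (Hom_group R (res0 R M) N)"

definition Ext1 ::
  "('a, 'c) ring_scheme \<Rightarrow> ('a, 'm, 'd) module_scheme \<Rightarrow> ('a, 'n, 'e) module_scheme \<Rightarrow>
    ((('m \<Rightarrow> 'a) \<Rightarrow> 'a) \<Rightarrow> 'n) set monoid"
  where "Ext1 R M N =
    (Hom_group R (res1 R M) N)\<lparr>carrier := Ext1_cocycles R M N\<rparr> Mod Ext1_coboundaries R M N"


lemma Hom_group_comm_group:
  assumes "left_module R M" "left_module R N"
  shows "comm_group (Hom_group R M N)"
proof -
  interpret M: left_module R M by fact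
  interpret N: left_module R N by fact
  have smult_zero: "\<zero>\<^bsub>N\<^esub> = a \<odot>\<^bsub>N\<^esub> \<zero>\<^bsub>N\<^esub>" if "a \<in> carrier R" for a
    using N.smult_r_distr[of a "\<zero>\<^bsub>N\<^esub>" "\<zero>\<^bsub>N\<^esub>"] that
    by (metis N.M.add.l_cancel_one' N.M.r_zero N.M.zero_closed N.smult_closed)
  have smult_neg: "\<ominus>\<^bsub>N\<^esub> (a \<odot>\<^bsub>N\<^esub> x) = a \<odot>\<^bsub>N\<^esub> (\<ominus>\<^bsub>N\<^esub> x)" if "a \<in> carrier R" "x \<in> carrier N" for a x
    using N.smult_r_distr[of a "\<ominus>\<^bsub>N\<^esub> x" x] that smult_zero[of a]
    by (metis N.M.a_inv_closed N.M.l_neg N.M.minus_equality N.smult_closed)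
  note defs = Hom_group_def module_homs_def
  show ?thesis
  proof (rule comm_groupI)
    fix f assume f: "f \<in> carrier (Hom_group R M N)"
    let ?g = "\<lambda>x\<in>carrier M. \<ominus>\<^bsub>N\<^esub> f x"
    show "\<exists>g\<in>carrier (Hom_group R M N). g \<otimes>\<^bsub>Hom_group R M N\<^esub> f = \<one>\<^bsub>Hom_group R M N\<^esub>"
    proof (rule bexI)
      show "?g \<otimes>\<^bsub>Hom_group R M N\<^esub> f = \<one>\<^bsub>Hom_group R M N\<^esub>"
        using f by (auto simp: defs N.M.l_neg PiE_iff intro!: restrict_ext)
      show "?g \<in> carrier (Hom_group R M N)"
        using f by (auto simp: defs PiE_iff N.M.minus_add smult_neg)
    qed
  next
    fix f assume "f \<in> carrier (Hom_group R M N)"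
    then show "\<one>\<^bsub>Hom_group R M N\<^esub> \<otimes>\<^bsub>Hom_group R M N\<^esub> f = f"
      by (auto simp: defs PiE_iff intro!: extensionalityI[of _ "carrier M"])
  qed (auto simp: defs PiE_iff smult_zero[symmetric] N.smult_r_distr N.M.a_ac intro!: restrict_ext)
qed

lemma module_homs_compose:
  assumes "restrict d (carrier P) \<in> module_homs R P Q" "g \<in> module_homs R Q N"
    and "left_module R P"
  shows "compose (carrier P) g d \<in> module_homs R P N"
proof -
  interpret P: left_module R P by fact
  show ?thesis
    using assms(1,2) by (auto simp: module_homs_def compose_def PiE_iff)
qed

lemma compose_group_hom:
  assumes d: "restrict d (carrier P) \<in> module_homs R P Q"
    and "left_module R P" "left_module R Q" "left_module R N"
  shows "group_hom (Hom_group R Q N) (Hom_group R P N) (\<lambda>g. compose (carrier P) g d)"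
proof -
  interpret QN: comm_group "Hom_group R Q N"
    by (rule Hom_group_comm_group) fact+
  interpret PN: comm_group "Hom_group R P N"
    by (rule Hom_group_comm_group) fact+
  have "d x \<in> carrier Q" if "x \<in> carrier P" for x
    using d that by (auto simp: module_homs_def PiE_iff)
  then have "(\<lambda>g. compose (carrier P) g d) \<in> hom (Hom_group R Q N) (Hom_group R P N)"
    using module_homs_compose[OF d _ assms(2)]
    by (auto simp: hom_def Hom_group_def compose_def intro!: restrict_ext)
  then show ?thesis
    by (simp add: group_hom_def group_hom_axioms_def QN.is_group PN.is_group)
qed

context
  fixes R :: "('a, 'c) ring_scheme" and M :: "('a, 'm, 'd) module_scheme"
  assumes M: "left_module R M"
begin

interpretation M: left_module R M by (rule M)

lemma res_left_module:
  "left_module R (res0 R M)" "left_module R (res1 R M)" "left_module R (res2 R M)"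
  unfolding res0_def res1_def res2_def
  by (rule free_module_left_module, rule M.R.ring_axioms)+

lemma a_kernel_subset: "a_kernel G H h \<subseteq> carrier G"
  by (auto simp: a_kernel_def')

lemma res_maps:
  "restrict (free_eval R M) (carrier (res0 R M)) \<in> module_homs R (res0 R M) M"
  "restrict (free_eval R (res0 R M)) (carrier (res1 R M)) \<in> module_homs R (res1 R M) (res0 R M)"
  "restrict (free_eval R (res1 R M)) (carrier (res2 R M)) \<in> module_homs R (res2 R M) (res1 R M)"
  unfolding res0_def[of R M] res1_def[of R M] res2_def[of R M]
  by (rule left_module.free_eval_hom; (intro M a_kernel_subset subset_refl free_module_left_module M.R.ring_axioms)?)+

end

lemma module_hom_zero:
  assumes "left_module R P" "left_module R Q" "f \<in> module_homs R P Q"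
  shows "f \<zero>\<^bsub>P\<^esub> = \<zero>\<^bsub>Q\<^esub>"
proof -
  interpret P: left_module R P by fact
  interpret Q: left_module R Q by fact
  have "f \<zero>\<^bsub>P\<^esub> \<in> carrier Q"
    using assms(3) by (auto simp: module_homs_def PiE_iff)
  moreover have "f (\<zero>\<^bsub>P\<^esub> \<oplus>\<^bsub>P\<^esub> \<zero>\<^bsub>P\<^esub>) = f \<zero>\<^bsub>P\<^esub> \<oplus>\<^bsub>Q\<^esub> f \<zero>\<^bsub>P\<^esub>"
    using assms(3) P.M.zero_closed unfolding module_homs_def by blast
  ultimately show ?thesis
    by (metis P.M.r_zero P.M.zero_closed Q.M.add.l_cancel_one')
qed

lemma free_eval_kernel:
  fixes d :: "'p \<Rightarrow> 'q"
  assumes "left_module R P" "left_module R Q"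
    and d: "restrict d (carrier P) \<in> module_homs R P Q"
  shows "free_eval R P ` carrier (free_module R (a_kernel P Q d)) = a_kernel P Q d"
proof (intro equalityI subsetI)
  interpret P: left_module R P by fact
  interpret Q: left_module R Q by fact
  have d': "\<And>x. x \<in> carrier P \<Longrightarrow> d x \<in> carrier Q"
    "\<And>x y. \<lbrakk>x \<in> carrier P; y \<in> carrier P\<rbrakk> \<Longrightarrow> d (x \<oplus>\<^bsub>P\<^esub> y) = d x \<oplus>\<^bsub>Q\<^esub> d y"
    "\<And>a x. \<lbrakk>a \<in> carrier R; x \<in> carrier P\<rbrakk> \<Longrightarrow> d (a \<odot>\<^bsub>P\<^esub> x) = a \<odot>\<^bsub>Q\<^esub> d x"
    using d by (auto simp: module_homs_def PiE_iff)
  have z: "d \<zero>\<^bsub>P\<^esub> = \<zero>\<^bsub>Q\<^esub>"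
    using module_hom_zero[OF assms] by simp
  have az: "a \<odot>\<^bsub>Q\<^esub> \<zero>\<^bsub>Q\<^esub> = \<zero>\<^bsub>Q\<^esub>" if "a \<in> carrier R" for a
    using Q.smult_r_distr[of a "\<zero>\<^bsub>Q\<^esub>" "\<zero>\<^bsub>Q\<^esub>"] that
    by (metis Q.M.add.l_cancel_one' Q.M.r_zero Q.M.zero_closed Q.smult_closed)
  have sum: "(\<Oplus>\<^bsub>P\<^esub>x\<in>B. h x) \<in> a_kernel P Q d"
    if "finite B" "h \<in> B \<rightarrow> a_kernel P Q d" for B and h :: "'p \<Rightarrow> 'p"
    using that
  proof (induction B rule: finite_induct)
    case empty
    then show ?case using z by (simp add: a_kernel_def')
  next
    case (insert x B)
    have "h x \<in> a_kernel P Q d" "h \<in> B \<rightarrow> a_kernel P Q d"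
      using insert.prems by auto
    moreover from this(2) have "(\<Oplus>\<^bsub>P\<^esub>x\<in>B. h x) \<in> a_kernel P Q d"
      by (rule insert.IH)
    moreover have "h \<in> B \<rightarrow> carrier P" using calculation(2) by (auto simp: a_kernel_def')
    ultimately show ?case
      using insert.hyps by (simp add: a_kernel_def' d')
  qed
  fix u
  {
    assume "u \<in> free_eval R P ` carrier (free_module R (a_kernel P Q d))"
    then obtain f where f: "f \<in> carrier (free_module R (a_kernel P Q d))" "u = free_eval R P f"
      by blast
    have fin: "finite {x. f x \<noteq> \<zero>\<^bsub>R\<^esub>}" and "f x \<in> carrier R"
      and "f x \<noteq> \<zero>\<^bsub>R\<^esub> \<Longrightarrow> x \<in> carrier P \<and> d x = \<zero>\<^bsub>Q\<^esub>" for x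
      using f(1) by (auto simp: free_module_def a_kernel_def')
    then have "(\<lambda>x. f x \<odot>\<^bsub>P\<^esub> x) \<in> {x. f x \<noteq> \<zero>\<^bsub>R\<^esub>} \<rightarrow> a_kernel P Q d"
      by (simp add: a_kernel_def' d' az)
    with fin show "u \<in> a_kernel P Q d"
      unfolding f(2) free_eval_def by (rule sum)
  }
  {
    assume "u \<in> a_kernel P Q d"
    then show "u \<in> free_eval R P ` carrier (free_module R (a_kernel P Q d))"
      by (intro P.free_eval_image) (auto simp: a_kernel_def')
  }
qed

lemma res_exact:
  assumes "left_module R M"
  shows "free_eval R M ` carrier (res0 R M) = carrier M"
    and "free_eval R (res0 R M) ` carrier (res1 R M) = a_kernel (res0 R M) M (free_eval R M)"
    and "free_eval R (res1 R M) ` carrier (res2 R M) =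
      a_kernel (res1 R M) (res0 R M) (free_eval R (res0 R M))"
proof -
  interpret M: left_module R M by fact
  have "free_eval R M x \<in> carrier M" if "x \<in> carrier (res0 R M)" for x
    using res_maps(1)[OF assms] that by (auto simp: module_homs_def PiE_iff)
  moreover have "x \<in> free_eval R M ` carrier (res0 R M)" if "x \<in> carrier M" for x
    unfolding res0_def using that by (intro M.free_eval_image) auto
  ultimately show "free_eval R M ` carrier (res0 R M) = carrier M"
    by blast
  show "free_eval R (res0 R M) ` carrier (res1 R M) = a_kernel (res0 R M) M (free_eval R M)"
    unfolding res1_def
    by (intro free_eval_kernel res_left_module[OF assms] assms res_maps(1))
  show "free_eval R (res1 R M) ` carrier (res2 R M) =
      a_kernel (res1 R M) (res0 R M) (free_eval R (res0 R M))"
    unfolding res2_def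
    by (intro free_eval_kernel res_left_module[OF assms] assms res_maps(2)[OF assms])
qed

lemma Ext1_coboundaries_subset:
  assumes M: "left_module R M" and N: "left_module R N"
  shows "Ext1_coboundaries R M N \<subseteq> Ext1_cocycles R M N"
proof
  fix f assume "f \<in> Ext1_coboundaries R M N"
  then obtain g where g: "g \<in> module_homs R (res0 R M) N"
    and f: "f = compose (carrier (res1 R M)) g (free_eval R (res0 R M))"
    by (auto simp: Ext1_coboundaries_def Hom_group_def)
  have "f \<in> module_homs R (res1 R M) N"
    unfolding f by (rule module_homs_compose[OF res_maps(2)[OF M] g res_left_module(2)[OF M]])
  moreover have "compose (carrier (res2 R M)) f (free_eval R (res1 R M)) = (\<lambda>x\<in>carrier (res2 R M). \<zero>\<^bsub>N\<^esub>)"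
  proof (unfold compose_def, rule restrict_ext)
    fix x assume "x \<in> carrier (res2 R M)"
    then have "free_eval R (res1 R M) x \<in> a_kernel (res1 R M) (res0 R M) (free_eval R (res0 R M))"
      using res_exact(3)[OF M] by blast
    then show "f (free_eval R (res1 R M) x) = \<zero>\<^bsub>N\<^esub>"
      using module_hom_zero[OF res_left_module(1)[OF M] N g]
      by (simp add: f a_kernel_def' compose_def)
  qed
  ultimately show "f \<in> Ext1_cocycles R M N"
    by (simp add: Ext1_cocycles_def kernel_def Hom_group_def)
qed

lemma Ext1_comm_group:
  assumes M: "left_module R M" and N: "left_module R N"
  shows "comm_group (Ext1 R M N)"
proof -
  let ?H = "Hom_group R (res1 R M) N"
  let ?Z = "?H\<lparr>carrier := Ext1_cocycles R M N\<rparr>"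
  interpret H: comm_group ?H
    by (rule Hom_group_comm_group[OF res_left_module(2)[OF M] N])
  have Z: "subgroup (Ext1_cocycles R M N) ?H"
    unfolding Ext1_cocycles_def
    by (intro group_hom.subgroup_kernel compose_group_hom res_maps res_left_module M N)
  have B: "subgroup (Ext1_coboundaries R M N) ?H"
    unfolding Ext1_coboundaries_def
    by (intro group_hom.img_is_subgroup compose_group_hom res_maps res_left_module M N)
  interpret Z: comm_group ?Z
  proof (rule group.group_comm_groupI)
    show "group ?Z" by (rule H.subgroup_imp_group[OF Z])
  qed (use subgroup.mem_carrier[OF Z] in \<open>simp add: H.m_comm\<close>)
  have "subgroup (Ext1_coboundaries R M N) ?Z"
    by (rule H.subgroup_incl[OF B Z Ext1_coboundaries_subset[OF M N]])
  then show ?thesis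
    unfolding Ext1_def by (rule Z.abelian_FactGroup)
qed


section \<open>The ring \<open>k\<langle>x,y\<rangle>/(xy - yx - y\<^sup>2)\<close>\<close>

datatype letter = Lx | Ly

text \<open>
  The free monoid on two letters, written additively, so that its monoid algebra is an instance
  of the convolution ring of \<^theory>\<open>HOL-Library.Poly_Mapping\<close>.
\<close>

datatype word = Word (letters: "letter list")

instantiation word :: monoid_add
begin

definition "0 = Word []"
definition "u + v = Word (letters u @ letters v)"

instance
  by standard (auto simp: zero_word_def plus_word_def)

end

type_synonym 'k free_algebra = "word \<Rightarrow>\<^sub>0 'k"

definition var :: "letter \<Rightarrow> 'k::comm_ring_1 free_algebra"
  where "var l = Poly_Mapping.single (Word [l]) 1"

definition jordan_ideal :: "'k::comm_ring_1 free_algebra set"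
  where "jordan_ideal =
    Idl\<^bsub>ring_of_type_algebra\<^esub> {var Lx * var Ly - var Ly * var Lx - var Ly * var Ly}"

definition jordan_plane :: "'k::comm_ring_1 free_algebra set ring"
  where "jordan_plane = ring_of_type_algebra Quot jordan_ideal"


lemma ring_of_type_algebra_ring: "ring (ring_of_type_algebra :: 'a::ring_1 ring)"
proof (intro ringI abelian_groupI monoidI)
  fix x :: 'a assume "x \<in> carrier ring_of_type_algebra"
  show "\<exists>y\<in>carrier ring_of_type_algebra. y \<oplus>\<^bsub>ring_of_type_algebra\<^esub> x = \<zero>\<^bsub>ring_of_type_algebra\<^esub>"
    by (rule bexI[of _ "- x"]) (simp_all add: ring_of_type_algebra_def)
qed (simp_all add: ring_of_type_algebra_def algebra_simps)

lemma jordan_ideal_ideal: "ideal jordan_ideal (ring_of_type_algebra :: 'k::comm_ring_1 free_algebra ring)"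
proof -
  interpret F: ring "ring_of_type_algebra :: 'k free_algebra ring"
    by (rule ring_of_type_algebra_ring)
  show ?thesis
    unfolding jordan_ideal_def by (rule F.genideal_ideal) (simp add: ring_of_type_algebra_def)
qed

lemma jordan_plane_ring: "ring (jordan_plane :: 'k::comm_ring_1 free_algebra set ring)"
  unfolding jordan_plane_def by (rule ideal.quotient_is_ring[OF jordan_ideal_ideal])


section \<open>The modules \<open>S\<^sub>\<alpha>\<close>\<close>

definition word_eval :: "'k::comm_ring_1 \<Rightarrow> 'k \<Rightarrow> word \<Rightarrow> 'k"
  where "word_eval a b w = prod_list (map (case_letter a b) (letters w))"

definition eval_at :: "'k::comm_ring_1 \<Rightarrow> 'k \<Rightarrow> 'k free_algebra \<Rightarrow> 'k"
  where "eval_at a b p = (\<Sum>w\<in>Poly_Mapping.keys p. Poly_Mapping.lookup p w * word_eval a b w)"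

text \<open>
  An element of \<^const>\<open>jordan_plane\<close> is a coset, on which evaluation at \<open>(\<alpha>, 0)\<close> is constant;
  see \<open>S_module_smult\<close> below.
\<close>

definition S_module :: "'k::comm_ring_1 \<Rightarrow> ('k free_algebra set, 'k) module"
  where "S_module \<alpha> =
    \<lparr>carrier = UNIV, monoid.mult = (*), monoid.one = 1, ring.zero = 0, ring.add = (+),
     module.smult = (\<lambda>A v. the_elem (eval_at \<alpha> 0 ` A) * v)\<rparr>"

lemma eval_at_superset:
  assumes "finite B" "Poly_Mapping.keys p \<subseteq> B"
  shows "eval_at a b p = (\<Sum>w\<in>B. Poly_Mapping.lookup p w * word_eval a b w)"
  unfolding eval_at_def using assms
  by (intro sum.mono_neutral_left) (auto simp: in_keys_iff)

lemma eval_at_add: "eval_at a b (p + q) = eval_at a b p + eval_at a b q"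
proof -
  let ?B = "Poly_Mapping.keys p \<union> Poly_Mapping.keys q"
  have "finite ?B" "Poly_Mapping.keys (p + q) \<subseteq> ?B"
    by (auto simp: keys_add)
  then show ?thesis
    by (simp add: eval_at_superset[of ?B] lookup_add ring_distribs sum.distrib)
qed

lemma eval_at_single: "eval_at a b (Poly_Mapping.single w c) = c * word_eval a b w"
  by (simp add: eval_at_superset[of "{w}"])

lemma word_eval_add: "word_eval a b (v + w) = word_eval a b v * word_eval a b w"
  by (simp add: word_eval_def plus_word_def)

lemma free_algebra_induct [case_names single sum]:
  fixes p :: "'k::comm_ring_1 free_algebra"
  assumes "\<And>w c. P (Poly_Mapping.single w c)"
    and "\<And>p q. P p \<Longrightarrow> P q \<Longrightarrow> P (p + q)"
  shows "P p"
proof -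
  have "P (\<Sum>w\<in>B. Poly_Mapping.single w (Poly_Mapping.lookup p w))" if "finite B" for B
    using that
  proof (induction B rule: finite_induct)
    case empty
    show ?case using assms(1)[of 0 0] by simp
  qed (simp add: assms)
  then have "P (\<Sum>w\<in>Poly_Mapping.keys p. Poly_Mapping.single w (Poly_Mapping.lookup p w))"
    by simp
  also have "(\<Sum>w\<in>Poly_Mapping.keys p. Poly_Mapping.single w (Poly_Mapping.lookup p w)) = p"
    by (rule poly_mapping_eqI) (simp add: lookup_sum lookup_single when_def in_keys_iff)
  finally show ?thesis .
qed

lemma eval_at_mult: "eval_at a b (p * q) = eval_at a b p * eval_at a b q"
proof (induction p rule: free_algebra_induct)
  case (single v c)
  show ?case
  proof (induction q rule: free_algebra_induct)
    case (single w d)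
    then show ?case
      by (simp add: mult_single eval_at_single word_eval_add)
  next
    case (sum q r)
    then show ?case by (simp add: distrib_left eval_at_add)
  qed
next
  case (sum p q)
  then show ?case by (simp add: distrib_right eval_at_add)
qed

lemma eval_at_var: "eval_at a b (var l) = case_letter a b l"
  by (simp add: var_def eval_at_single word_eval_def)

lemma eval_at_one: "eval_at a b 1 = 1"
  using eval_at_single[of a b 0 1, unfolded single_one] by (simp add: word_eval_def zero_word_def)

lemma eval_at_ring_hom:
  "eval_at a b \<in> ring_hom ring_of_type_algebra ring_of_type_algebra"
  by (auto simp: ring_hom_def ring_of_type_algebra_def eval_at_mult eval_at_add eval_at_one)

lemma eval_at_jordan_ideal:
  fixes p :: "'k::comm_ring_1 free_algebra"
  assumes "p \<in> jordan_ideal"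
  shows "eval_at \<alpha> 0 p = 0"
proof -
  let ?F = "ring_of_type_algebra :: 'k free_algebra ring"
  let ?K = "ring_of_type_algebra :: 'k ring"
  have car: "carrier ?F = UNIV" and zero: "\<zero>\<^bsub>?K\<^esub> = 0"
    by (simp_all add: ring_of_type_algebra_def)
  have ker: "a_kernel ?F ?K (eval_at \<alpha> 0) = {p. eval_at \<alpha> 0 p = 0}"
    unfolding a_kernel_def' car zero by simp
  have diff: "eval_at \<alpha> 0 (p - q) = eval_at \<alpha> 0 p - eval_at \<alpha> 0 q" for p q
    using eval_at_add[of \<alpha> 0 "p - q" q] by (simp add: eq_diff_eq)
  have "ring_hom_ring ?F ?K (eval_at \<alpha> 0)"
    by (intro ring_hom_ringI2 ring_of_type_algebra_ring eval_at_ring_hom)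
  then have "ideal (a_kernel ?F ?K (eval_at \<alpha> 0)) ?F"
    by (rule ring_hom_ring.kernel_is_ideal)
  then have "jordan_ideal \<subseteq> {p. eval_at \<alpha> 0 p = 0}"
    unfolding jordan_ideal_def ker
    by (rule ring.genideal_minimal[OF ring_of_type_algebra_ring])
      (simp add: diff eval_at_mult eval_at_var)
  with assms show ?thesis by auto
qed

abbreviation jordan_class :: "'k::comm_ring_1 free_algebra \<Rightarrow> 'k free_algebra set"
  where "jordan_class p \<equiv> jordan_ideal +>\<^bsub>ring_of_type_algebra\<^esub> p"

lemma carrier_jordan_plane: "carrier jordan_plane = range jordan_class"
proof -
  have "carrier ring_of_type_algebra = (UNIV :: 'a free_algebra set)"
    by (simp add: ring_of_type_algebra_def)
  then show ?thesis
    by (auto simp: jordan_plane_def FactRing_def A_RCOSETS_def')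
qed

lemma S_module_smult:
  fixes p :: "'k::comm_ring_1 free_algebra"
  shows "jordan_class p \<odot>\<^bsub>S_module \<alpha>\<^esub> v = eval_at \<alpha> 0 p * v"
proof -
  interpret I: ideal jordan_ideal "ring_of_type_algebra :: 'k free_algebra ring"
    by (rule jordan_ideal_ideal)
  have "jordan_class p = (\<lambda>i. i + p) ` jordan_ideal"
    by (auto simp: a_r_coset_def' ring_of_type_algebra_def)
  then have "eval_at \<alpha> 0 ` jordan_class p = (\<lambda>i::'k free_algebra. eval_at \<alpha> 0 p) ` jordan_ideal"
    by (simp add: image_image eval_at_add eval_at_jordan_ideal)
  also have "\<dots> = {eval_at \<alpha> 0 p}"
    using additive_subgroup.zero_closed[OF I.additive_subgroup_axioms] by blast
  finally show ?thesis by (simp add: S_module_def)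
qed

lemma S_module_x: "jordan_class (var Lx) \<odot>\<^bsub>S_module \<alpha>\<^esub> v = \<alpha> * v"
  and S_module_y: "jordan_class (var Ly) \<odot>\<^bsub>S_module \<alpha>\<^esub> v = 0"
  by (simp_all add: S_module_smult eval_at_var)

lemma S_module_left_module: "left_module jordan_plane (S_module \<alpha>)"
proof -
  interpret I: ideal jordan_ideal "ring_of_type_algebra :: 'a free_algebra ring"
    by (rule jordan_ideal_ideal)
  have add: "jordan_class p \<oplus>\<^bsub>jordan_plane\<^esub> jordan_class q = jordan_class (p + q)" for p q :: "'a free_algebra"
    using I.a_rcos_sum[of p q] by (simp add: jordan_plane_def FactRing_def ring_of_type_algebra_def)
  have mult: "jordan_class p \<otimes>\<^bsub>jordan_plane\<^esub> jordan_class q = jordan_class (p * q)" for p q :: "'a free_algebra"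
    using I.rcoset_mult_add[of p q] by (simp add: jordan_plane_def FactRing_def ring_of_type_algebra_def)
  have one: "\<one>\<^bsub>jordan_plane\<^esub> = jordan_class (1 :: 'a free_algebra)"
    by (simp add: jordan_plane_def FactRing_def ring_of_type_algebra_def)
  have fields: "carrier (S_module \<alpha>) = UNIV" "\<zero>\<^bsub>S_module \<alpha>\<^esub> = 0" "x \<oplus>\<^bsub>S_module \<alpha>\<^esub> y = x + y" for x y
    by (simp_all add: S_module_def)
  have "abelian_group (S_module \<alpha>)"
  proof (rule abelian_groupI)
    fix v assume "v \<in> carrier (S_module \<alpha>)"
    show "\<exists>w\<in>carrier (S_module \<alpha>). w \<oplus>\<^bsub>S_module \<alpha>\<^esub> v = \<zero>\<^bsub>S_module \<alpha>\<^esub>"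
      by (rule bexI[of _ "- v"]) (simp_all add: fields)
  qed (simp_all add: fields algebra_simps)
  then show ?thesis
    by (auto simp: left_module_def left_module_axioms_def jordan_plane_ring carrier_jordan_plane
        add mult one fields S_module_smult eval_at_add eval_at_mult eval_at_one algebra_simps)
qed

end

theory Submission
  imports Defs "HOL-Algebra.Ideal_Product"
begin

text \<open>
  A cocycle is a linear map \<open>f\<close> on the first term \<open>P\<^sub>1\<close> of the resolution which factors through
  the kernel \<open>K\<close> of \<open>P\<^sub>0 \<rightarrow> S\<^sub>\<alpha>\<close>, as \<open>f = \<phi> \<circ> d\<close> say, and it is a coboundary as soon as
  \<open>\<phi> : K \<rightarrow> S\<^sub>\<beta>\<close> extends linearly to \<open>P\<^sub>0\<close>.  An extension can be written down: the
  element \<open>c = (x - \<alpha>) / (\<beta> - \<alpha>)\<close> kills \<open>S\<^sub>\<alpha>\<close>, so it maps \<open>P\<^sub>0\<close> into \<open>K\<close>, and it acts as the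
  identity on \<open>S\<^sub>\<beta>\<close>, so \<open>g p = \<phi> (c p)\<close> agrees with \<open>\<phi>\<close> on \<open>K\<close>.

  The map \<open>g\<close> is linear provided that \<open>\<phi>\<close> kills \<open>(c r - r c) P\<^sub>0\<close> for all scalars \<open>r\<close>.  A
  product \<open>j i\<close> with \<open>j\<close> in the annihilator of \<open>S\<^sub>\<beta>\<close> and \<open>i\<close> in that of \<open>S\<^sub>\<alpha>\<close> satisfies
  \<open>\<phi> (j i p) = j \<phi> (i p) = 0\<close>, so it suffices that \<open>c\<close> be central modulo the product of the two
  annihilators; this is \<open>Ext1_trivial_if_almost_central\<close>.  In the Jordan plane the
  commutator with \<open>x\<close> is a derivation which vanishes on \<open>x\<close> and maps \<open>y\<close> to \<open>y\<^sup>2\<close>, and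
  \<open>y\<^sup>2 = y \<cdot> y\<close> lies in that product because \<open>y\<close> annihilates both modules.
\<close>

section \<open>Annihilators\<close>

definition annihilator :: "('a, 'c) ring_scheme \<Rightarrow> ('a, 'm, 'd) module_scheme \<Rightarrow> 'a set"
  where "annihilator R M = {a \<in> carrier R. \<forall>x\<in>carrier M. a \<odot>\<^bsub>M\<^esub> x = \<zero>\<^bsub>M\<^esub>}"

context left_module
begin

lemma smult_l_null: "x \<in> carrier M \<Longrightarrow> \<zero> \<odot>\<^bsub>M\<^esub> x = \<zero>\<^bsub>M\<^esub>"
  using smult_l_distr[of \<zero> \<zero> x]
  by (metis M.add.l_cancel_one' R.r_zero R.zero_closed smult_closed)

lemma smult_r_null: "a \<in> carrier R \<Longrightarrow> a \<odot>\<^bsub>M\<^esub> \<zero>\<^bsub>M\<^esub> = \<zero>\<^bsub>M\<^esub>"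
  using smult_r_distr[of a "\<zero>\<^bsub>M\<^esub>" "\<zero>\<^bsub>M\<^esub>"]
  by (metis M.add.l_cancel_one' M.r_zero M.zero_closed smult_closed)

lemma smult_l_minus:
  assumes "a \<in> carrier R" "x \<in> carrier M"
  shows "(\<ominus> a) \<odot>\<^bsub>M\<^esub> x = \<ominus>\<^bsub>M\<^esub> (a \<odot>\<^bsub>M\<^esub> x)"
proof -
  have "(\<ominus> a) \<odot>\<^bsub>M\<^esub> x \<oplus>\<^bsub>M\<^esub> a \<odot>\<^bsub>M\<^esub> x = \<zero>\<^bsub>M\<^esub>"
    using assms smult_l_distr[of "\<ominus> a" a x] by (simp add: R.l_neg smult_l_null)
  then show ?thesis
    using assms by (metis M.minus_equality R.a_inv_closed smult_closed)
qed

lemma annihilator_ideal: "ideal (annihilator R M) R"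
proof (rule idealI)
  show "subgroup (annihilator R M) (add_monoid R)"
  proof (rule group.subgroupI)
    have "\<zero> \<in> annihilator R M"
      by (simp add: annihilator_def smult_l_null)
    then show "annihilator R M \<noteq> {}" by blast
  next
    fix a assume "a \<in> annihilator R M"
    then have "\<ominus> a \<in> annihilator R M"
      by (auto simp: annihilator_def smult_l_minus)
    then show "inv\<^bsub>add_monoid R\<^esub> a \<in> annihilator R M"
      by (simp add: a_inv_def)
  qed (auto simp: annihilator_def smult_l_distr R.add.is_group)
qed (auto simp: annihilator_def smult_assoc smult_r_null R.ring_axioms)

end


section \<open>A criterion for the vanishing of \<open>Ext\<^sup>1\<close>\<close>

lemma Ext1_trivial_if_cocycles_bound:
  assumes M: "left_module R M" and N: "left_module R N"
    and "Ext1_cocycles R M N \<subseteq> Ext1_coboundaries R M N"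
  shows "trivial_group (Ext1 R M N)"
proof -
  let ?Z = "Ext1_cocycles R M N"
  let ?H = "Hom_group R (res1 R M) N"
  have eq: "Ext1_coboundaries R M N = ?Z"
    using assms Ext1_coboundaries_subset by blast
  interpret H: comm_group ?H
    by (rule Hom_group_comm_group[OF res_left_module(2)[OF M] N])
  have Z: "subgroup ?Z ?H"
    unfolding Ext1_cocycles_def
    by (intro group_hom.subgroup_kernel compose_group_hom res_maps res_left_module M N)
  interpret Z: group "?H\<lparr>carrier := ?Z\<rparr>"
    by (rule H.subgroup_imp_group[OF Z])
  have "carrier (Ext1 R M N) = {?Z}"
    using Z.coset_join2[OF _ Z.subgroup_self] Z.one_closed
    by (auto simp: Ext1_def eq FactGroup_def RCOSETS_def)
  moreover have "\<one>\<^bsub>Ext1 R M N\<^esub> = ?Z"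
    by (simp add: Ext1_def eq FactGroup_def)
  moreover have "group (Ext1 R M N)"
    using Ext1_comm_group[OF M N] by (simp add: comm_group.axioms)
  ultimately show ?thesis
    by (simp add: trivial_group_def)
qed

text \<open>
  By exactness of the resolution at \<open>P\<^sub>1\<close>, the value of a cocycle at \<open>q\<close> depends on \<open>d q\<close> only.
\<close>

lemma Ext1_cocycle_factors:
  assumes M: "left_module R M" and N: "left_module R N"
    and f: "f \<in> Ext1_cocycles R M N"
  obtains \<phi> where "\<And>q. q \<in> carrier (res1 R M) \<Longrightarrow> \<phi> (free_eval R (res0 R M) q) = f q"
proof -
  interpret N: left_module R N by (rule N)
  interpret P0: left_module R "res0 R M" by (rule res_left_module[OF M])
  interpret P1: left_module R "res1 R M" by (rule res_left_module[OF M])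
  let ?d = "free_eval R (res0 R M)"
  have f_hom: "f \<in> module_homs R (res1 R M) N"
    and f_res2: "compose (carrier (res2 R M)) f (free_eval R (res1 R M)) = (\<lambda>x\<in>carrier (res2 R M). \<zero>\<^bsub>N\<^esub>)"
    using f by (auto simp: Ext1_cocycles_def kernel_def Hom_group_def)
  have f_add: "f (q \<oplus>\<^bsub>res1 R M\<^esub> q') = f q \<oplus>\<^bsub>N\<^esub> f q'" and f_car: "f q \<in> carrier N"
    if "q \<in> carrier (res1 R M)" "q' \<in> carrier (res1 R M)" for q q'
    using f_hom that by (auto simp: module_homs_def)
  have d_add: "?d (q \<oplus>\<^bsub>res1 R M\<^esub> q') = ?d q \<oplus>\<^bsub>res0 R M\<^esub> ?d q'" and d_car: "?d q \<in> carrier (res0 R M)"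
    if "q \<in> carrier (res1 R M)" "q' \<in> carrier (res1 R M)" for q q'
    using res_maps(2)[OF M] that by (auto simp: module_homs_def PiE_iff)
  have f_ker: "f q = \<zero>\<^bsub>N\<^esub>" if q: "q \<in> carrier (res1 R M)" "?d q = \<zero>\<^bsub>res0 R M\<^esub>" for q
  proof -
    have "q \<in> a_kernel (res1 R M) (res0 R M) ?d"
      using q by (simp add: a_kernel_def')
    then obtain z where z: "z \<in> carrier (res2 R M)" "q = free_eval R (res1 R M) z"
      unfolding res_exact(3)[OF M, symmetric] by blast
    then show ?thesis
      using fun_cong[OF f_res2, of z] by (simp add: compose_def)
  qed
  have well_defined: "f q = f q'"
    if q: "q \<in> carrier (res1 R M)" "q' \<in> carrier (res1 R M)" "?d q = ?d q'" for q q'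
  proof -
    let ?m = "\<ominus>\<^bsub>res1 R M\<^esub> q'"
    have m: "?m \<in> carrier (res1 R M)" using q by simp
    have f0: "f (q' \<oplus>\<^bsub>res1 R M\<^esub> ?m) = \<zero>\<^bsub>N\<^esub>"
      using module_hom_zero[OF P1.left_module_axioms N f_hom] q by (simp add: P1.M.r_neg)
    have "?d (q \<oplus>\<^bsub>res1 R M\<^esub> ?m) = ?d (q' \<oplus>\<^bsub>res1 R M\<^esub> ?m)"
      using q m d_add by simp
    also have "\<dots> = \<zero>\<^bsub>res0 R M\<^esub>"
      using module_hom_zero[OF P1.left_module_axioms P0.left_module_axioms res_maps(2)[OF M]] q
      by (simp add: P1.M.r_neg)
    finally have "f (q \<oplus>\<^bsub>res1 R M\<^esub> ?m) = \<zero>\<^bsub>N\<^esub>"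
      using f_ker q m by simp
    with f0 have "f q \<oplus>\<^bsub>N\<^esub> f ?m = f q' \<oplus>\<^bsub>N\<^esub> f ?m"
      using f_add q m by simp
    then show ?thesis
      using f_car q m N.M.add.r_cancel by blast
  qed
  show ?thesis
  proof (rule that)
    fix q assume q: "q \<in> carrier (res1 R M)"
    then have d: "?d q \<in> ?d ` carrier (res1 R M)" by blast
    show "f (inv_into (carrier (res1 R M)) ?d (?d q)) = f q"
      by (rule well_defined[OF inv_into_into[OF d] q f_inv_into_f[OF d]])
  qed
qed

text \<open>
  If \<open>c\<close> were central, multiplication by \<open>c\<close> would act on \<open>Ext\<^sup>1\<close> both as \<open>0\<close> (through \<open>M\<close>) and
  as the identity (through \<open>N\<close>).  The argument survives if commutators with \<open>c\<close> are sums of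
  products \<open>j \<otimes> i\<close> with \<open>j\<close> killing \<open>N\<close> and \<open>i\<close> killing \<open>M\<close>, because \<open>i\<close> moves any element of
  \<open>P\<^sub>0\<close> into the kernel on which \<open>\<phi>\<close> is linear, and then \<open>j\<close> kills the value.
\<close>

theorem Ext1_trivial_if_almost_central:
  assumes M: "left_module R M" and N: "left_module R N"
    and c: "c \<in> annihilator R M"
    and c_id: "\<And>v. v \<in> carrier N \<Longrightarrow> c \<odot>\<^bsub>N\<^esub> v = v"
    and comm: "\<And>r. r \<in> carrier R \<Longrightarrow>
      c \<otimes>\<^bsub>R\<^esub> r \<ominus>\<^bsub>R\<^esub> r \<otimes>\<^bsub>R\<^esub> c \<in> ideal_prod R (annihilator R N) (annihilator R M)"
  shows "trivial_group (Ext1 R M N)"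
proof (rule Ext1_trivial_if_cocycles_bound[OF M N], rule subsetI)
  fix f assume f: "f \<in> Ext1_cocycles R M N"
  interpret M: left_module R M by (rule M)
  interpret N: left_module R N by (rule N)
  let ?P0 = "res0 R M" and ?P1 = "res1 R M"
  interpret P0: left_module R ?P0 by (rule res_left_module[OF M])
  interpret P1: left_module R ?P1 by (rule res_left_module[OF M])
  let ?e = "free_eval R M" and ?d = "free_eval R ?P0"
  let ?K = "a_kernel ?P0 M ?e"
  obtain \<phi> where \<phi>: "\<And>q. q \<in> carrier ?P1 \<Longrightarrow> \<phi> (?d q) = f q"
    using Ext1_cocycle_factors[OF M N f] by blast
  have f_hom: "f \<in> module_homs R ?P1 N"
    using f by (auto simp: Ext1_cocycles_def kernel_def Hom_group_def)
  have fh: "f \<in> extensional (carrier ?P1)"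
    "\<And>q. q \<in> carrier ?P1 \<Longrightarrow> f q \<in> carrier N"
    "\<And>q q'. \<lbrakk>q \<in> carrier ?P1; q' \<in> carrier ?P1\<rbrakk> \<Longrightarrow> f (q \<oplus>\<^bsub>?P1\<^esub> q') = f q \<oplus>\<^bsub>N\<^esub> f q'"
    "\<And>a q. \<lbrakk>a \<in> carrier R; q \<in> carrier ?P1\<rbrakk> \<Longrightarrow> f (a \<odot>\<^bsub>?P1\<^esub> q) = a \<odot>\<^bsub>N\<^esub> f q"
    using f_hom by (auto simp: module_homs_def PiE_iff)
  have dh: "\<And>q. q \<in> carrier ?P1 \<Longrightarrow> ?d q \<in> carrier ?P0"
    "\<And>q q'. \<lbrakk>q \<in> carrier ?P1; q' \<in> carrier ?P1\<rbrakk> \<Longrightarrow> ?d (q \<oplus>\<^bsub>?P1\<^esub> q') = ?d q \<oplus>\<^bsub>?P0\<^esub> ?d q'"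
    "\<And>a q. \<lbrakk>a \<in> carrier R; q \<in> carrier ?P1\<rbrakk> \<Longrightarrow> ?d (a \<odot>\<^bsub>?P1\<^esub> q) = a \<odot>\<^bsub>?P0\<^esub> ?d q"
    using res_maps(2)[OF M] by (auto simp: module_homs_def PiE_iff)
  have eh: "\<And>p. p \<in> carrier ?P0 \<Longrightarrow> ?e p \<in> carrier M"
    "\<And>a p. \<lbrakk>a \<in> carrier R; p \<in> carrier ?P0\<rbrakk> \<Longrightarrow> ?e (a \<odot>\<^bsub>?P0\<^esub> p) = a \<odot>\<^bsub>M\<^esub> ?e p"
    using res_maps(1)[OF M] by (auto simp: module_homs_def PiE_iff)
  have K_image: "\<exists>q\<in>carrier ?P1. u = ?d q" if "u \<in> ?K" for u
    using that res_exact(2)[OF M] by blast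
  have K_d: "?d q \<in> ?K" if "q \<in> carrier ?P1" for q
    using that res_exact(2)[OF M] by blast
  have K_add: "u \<oplus>\<^bsub>?P0\<^esub> v \<in> ?K" and \<phi>_add: "\<phi> (u \<oplus>\<^bsub>?P0\<^esub> v) = \<phi> u \<oplus>\<^bsub>N\<^esub> \<phi> v"
    if uv: "u \<in> ?K" "v \<in> ?K" for u v
  proof -
    obtain q q' where q: "q \<in> carrier ?P1" "u = ?d q" "q' \<in> carrier ?P1" "v = ?d q'"
      using K_image uv by meson
    have eq: "u \<oplus>\<^bsub>?P0\<^esub> v = ?d (q \<oplus>\<^bsub>?P1\<^esub> q')"
      using q by (simp add: dh)
    show "u \<oplus>\<^bsub>?P0\<^esub> v \<in> ?K"
      unfolding eq using q by (intro K_d P1.M.a_closed)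
    have "\<phi> (u \<oplus>\<^bsub>?P0\<^esub> v) = f (q \<oplus>\<^bsub>?P1\<^esub> q')"
      unfolding eq using q by (intro \<phi> P1.M.a_closed)
    then show "\<phi> (u \<oplus>\<^bsub>?P0\<^esub> v) = \<phi> u \<oplus>\<^bsub>N\<^esub> \<phi> v"
      using q by (simp add: fh \<phi>)
  qed
  have K_smult: "a \<odot>\<^bsub>?P0\<^esub> u \<in> ?K" and \<phi>_smult: "\<phi> (a \<odot>\<^bsub>?P0\<^esub> u) = a \<odot>\<^bsub>N\<^esub> \<phi> u"
    and \<phi>_car: "\<phi> u \<in> carrier N"
    if u: "u \<in> ?K" and a: "a \<in> carrier R" for u a
  proof -
    obtain q where q: "q \<in> carrier ?P1" "u = ?d q"
      using K_image u by meson
    have eq: "a \<odot>\<^bsub>?P0\<^esub> u = ?d (a \<odot>\<^bsub>?P1\<^esub> q)"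
      using q a by (simp add: dh)
    show "a \<odot>\<^bsub>?P0\<^esub> u \<in> ?K"
      unfolding eq using q a by (intro K_d P1.smult_closed)
    have "\<phi> (a \<odot>\<^bsub>?P0\<^esub> u) = f (a \<odot>\<^bsub>?P1\<^esub> q)"
      unfolding eq using q a by (intro \<phi> P1.smult_closed)
    then show "\<phi> (a \<odot>\<^bsub>?P0\<^esub> u) = a \<odot>\<^bsub>N\<^esub> \<phi> u"
      using q a by (simp add: fh \<phi>)
    show "\<phi> u \<in> carrier N"
      using q by (simp add: fh \<phi>)
  qed
  have ann_K: "i \<odot>\<^bsub>?P0\<^esub> p \<in> ?K" if "i \<in> annihilator R M" "p \<in> carrier ?P0" for i p
    using that by (simp add: a_kernel_def' annihilator_def eh)
  have prod_kill: "w \<in> carrier R \<and> w \<odot>\<^bsub>?P0\<^esub> p \<in> ?K \<and> \<phi> (w \<odot>\<^bsub>?P0\<^esub> p) = \<zero>\<^bsub>N\<^esub>"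
    if "w \<in> ideal_prod R (annihilator R N) (annihilator R M)" and p: "p \<in> carrier ?P0" for w p
    using that(1)
  proof induction
    case (prod j i)
    then have ji: "j \<in> carrier R" "i \<in> carrier R" and j: "\<And>v. v \<in> carrier N \<Longrightarrow> j \<odot>\<^bsub>N\<^esub> v = \<zero>\<^bsub>N\<^esub>"
      by (auto simp: annihilator_def)
    have ip: "i \<odot>\<^bsub>?P0\<^esub> p \<in> ?K" by (rule ann_K[OF prod(2) p])
    show ?case
      using ji p K_smult[OF ip ji(1)] \<phi>_smult[OF ip ji(1)] j[OF \<phi>_car[OF ip ji(1)]]
      by (simp add: P0.smult_assoc)
  next
    case (sum w w')
    then show ?case
      using p K_add \<phi>_add by (simp add: P0.smult_l_distr)
  qed
  have c_car: "c \<in> carrier R" using c by (simp add: annihilator_def)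
  have cK: "c \<odot>\<^bsub>?P0\<^esub> p \<in> ?K" if "p \<in> carrier ?P0" for p
    using ann_K[OF c that] .
  let ?g = "\<lambda>p\<in>carrier ?P0. \<phi> (c \<odot>\<^bsub>?P0\<^esub> p)"
  have g_smult: "\<phi> (c \<odot>\<^bsub>?P0\<^esub> (r \<odot>\<^bsub>?P0\<^esub> p)) = r \<odot>\<^bsub>N\<^esub> \<phi> (c \<odot>\<^bsub>?P0\<^esub> p)"
    if r: "r \<in> carrier R" and p: "p \<in> carrier ?P0" for r p
  proof -
    let ?w = "c \<otimes>\<^bsub>R\<^esub> r \<ominus>\<^bsub>R\<^esub> r \<otimes>\<^bsub>R\<^esub> c"
    note w = prod_kill[OF comm[OF r] p]
    have "c \<otimes>\<^bsub>R\<^esub> r = ?w \<oplus>\<^bsub>R\<^esub> r \<otimes>\<^bsub>R\<^esub> c"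
      using r c_car by (simp add: M.R.minus_eq M.R.a_assoc M.R.l_neg)
    then have "c \<odot>\<^bsub>?P0\<^esub> (r \<odot>\<^bsub>?P0\<^esub> p) = ?w \<odot>\<^bsub>?P0\<^esub> p \<oplus>\<^bsub>?P0\<^esub> r \<odot>\<^bsub>?P0\<^esub> (c \<odot>\<^bsub>?P0\<^esub> p)"
      using r p c_car w by (metis P0.smult_assoc P0.smult_l_distr M.R.m_closed)
    then show ?thesis
      using w K_smult[OF cK[OF p] r] \<phi>_smult[OF cK[OF p] r] \<phi>_car[OF cK[OF p] r] r
      by (simp add: \<phi>_add)
  qed
  have "?g \<in> module_homs R ?P0 N"
    using g_smult \<phi>_car[OF cK c_car] \<phi>_add[OF cK cK] c_car
    by (auto simp: module_homs_def P0.smult_r_distr)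
  moreover have "f = compose (carrier ?P1) ?g ?d"
  proof (rule extensionalityI[OF fh(1) compose_extensional])
    fix q assume q: "q \<in> carrier ?P1"
    have "\<phi> (c \<odot>\<^bsub>?P0\<^esub> ?d q) = c \<odot>\<^bsub>N\<^esub> \<phi> (?d q)"
      by (rule \<phi>_smult[OF K_d[OF q] c_car])
    then show "f q = compose (carrier ?P1) ?g ?d q"
      using q by (simp add: compose_def dh \<phi> fh c_id)
  qed
  ultimately show "f \<in> Ext1_coboundaries R M N"
    by (auto simp: Ext1_coboundaries_def Hom_group_def)
qed


section \<open>The Jordan plane\<close>

lemma jordan_class_mult:
  "jordan_class p \<otimes>\<^bsub>jordan_plane\<^esub> jordan_class q = jordan_class (p * q)"
  using ideal.rcoset_mult_add[OF jordan_ideal_ideal, of p q]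
  by (simp add: jordan_plane_def FactRing_def ring_of_type_algebra_def)

lemma jordan_class_add:
  "jordan_class p \<oplus>\<^bsub>jordan_plane\<^esub> jordan_class q = jordan_class (p + q)"
proof -
  interpret I: ideal jordan_ideal "ring_of_type_algebra :: 'a free_algebra ring"
    by (rule jordan_ideal_ideal)
  show ?thesis
    using I.a_rcos_sum[of p q]
    by (simp add: jordan_plane_def FactRing_def ring_of_type_algebra_def)
qed

lemma jordan_class_diff:
  "jordan_class p \<ominus>\<^bsub>jordan_plane\<^esub> jordan_class q = jordan_class (p - q)"
proof -
  interpret R: ring jordan_plane by (rule jordan_plane_ring)
  have car: "jordan_class p \<in> carrier jordan_plane" for p :: "'a free_algebra"
    by (simp add: carrier_jordan_plane)
  have "jordan_class p = jordan_class (p - q) \<oplus>\<^bsub>jordan_plane\<^esub> jordan_class q"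
    by (simp add: jordan_class_add)
  then show ?thesis
    using car by (simp add: R.minus_eq R.a_assoc R.r_neg)
qed

lemma jordan_class_eq_if_diff:
  assumes "p - q \<in> jordan_ideal"
  shows "jordan_class p = jordan_class q"
proof -
  interpret R: ring jordan_plane by (rule jordan_plane_ring)
  interpret I: ideal jordan_ideal "ring_of_type_algebra :: 'a free_algebra ring"
    by (rule jordan_ideal_ideal)
  have "jordan_class (p - q) = \<zero>\<^bsub>jordan_plane\<^esub>"
    using I.a_rcos_const[OF assms] by (simp add: jordan_plane_def FactRing_def)
  moreover have "jordan_class p = jordan_class (p - q) \<oplus>\<^bsub>jordan_plane\<^esub> jordan_class q"
    by (simp add: jordan_class_add)
  moreover have "jordan_class q \<in> carrier jordan_plane"
    by (simp add: carrier_jordan_plane)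
  ultimately show ?thesis by simp
qed

lemma jordan_relation:
  "jordan_class (var Lx * var Ly - var Ly * var Lx) = jordan_class (var Ly * var Ly)"
proof (rule jordan_class_eq_if_diff)
  show "var Lx * var Ly - var Ly * var Lx - var Ly * var Ly \<in> jordan_ideal"
    unfolding jordan_ideal_def
    by (rule ring.genideal_self'[OF ring_of_type_algebra_ring]) (simp add: ring_of_type_algebra_def)
qed

lemma jordan_class_in_annihilator_S:
  "jordan_class p \<in> annihilator jordan_plane (S_module \<alpha>) \<longleftrightarrow> eval_at \<alpha> 0 p = 0"
proof -
  have "carrier (S_module \<alpha>) = UNIV" "\<zero>\<^bsub>S_module \<alpha>\<^esub> = 0"
    by (simp_all add: S_module_def)
  then show ?thesis
    by (auto simp: annihilator_def carrier_jordan_plane S_module_smult dest: spec[of _ 1])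
qed

text \<open>
  The commutator with \<open>x\<close> is a derivation, so it suffices to look at its values on the
  generators, of which only \<open>x y - y x = y\<^sup>2\<close> is nonzero.
\<close>

lemma commutator_x_in_ideal:
  fixes p :: "'k::comm_ring_1 free_algebra"
  assumes J: "ideal J jordan_plane" and y2: "jordan_class (var Ly * var Ly) \<in> J"
  shows "jordan_class (var Lx * p - p * var Lx) \<in> J"
proof -
  interpret J: ideal J "jordan_plane :: 'k free_algebra set ring" by (rule J)
  have car: "jordan_class p \<in> carrier jordan_plane" for p :: "'k free_algebra"
    by (simp add: carrier_jordan_plane)
  have add: "jordan_class (p + q) \<in> J" if "jordan_class p \<in> J" "jordan_class q \<in> J" for p q
    using additive_subgroup.a_closed[OF J.additive_subgroup_axioms that] by (simp add: jordan_class_add)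
  have left: "jordan_class (p * q) \<in> J" if "jordan_class q \<in> J" for p q
    using J.I_l_closed[OF that car] by (simp add: jordan_class_mult)
  have right: "jordan_class (p * q) \<in> J" if "jordan_class p \<in> J" for p q
    using J.I_r_closed[OF that car] by (simp add: jordan_class_mult)
  have zero: "jordan_class (0 :: 'k free_algebra) \<in> J"
    using left[OF y2, of 0] by simp
  have letter: "jordan_class (var Lx * var l - var l * var Lx :: 'k free_algebra) \<in> J" for l
    using zero y2 by (cases l) (simp_all add: jordan_relation)
  have word: "jordan_class (var Lx * Poly_Mapping.single (Word ls) c
      - Poly_Mapping.single (Word ls) c * var Lx) \<in> J" for ls and c :: 'k
  proof (induction ls)
    case Nil
    then show ?case
      using zero by (simp add: var_def mult_single plus_word_def)
  next
    case (Cons l ls)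
    let ?u = "Poly_Mapping.single (Word ls) c"
    have split: "Poly_Mapping.single (Word (l # ls)) c = var l * ?u"
      by (simp add: var_def mult_single plus_word_def)
    have "var Lx * (var l * ?u) - var l * ?u * var Lx
        = (var Lx * var l - var l * var Lx) * ?u + var l * (var Lx * ?u - ?u * var Lx)"
      by (simp add: algebra_simps)
    then show ?case
      unfolding split by (simp add: add left right letter Cons.IH)
  qed
  show ?thesis
  proof (induction p rule: free_algebra_induct)
    case (single w c)
    then show ?case
      using word[of "letters w" c] by simp
  next
    case (sum p q)
    have "var Lx * (p + q) - (p + q) * var Lx
        = (var Lx * p - p * var Lx) + (var Lx * q - q * var Lx)"
      by (simp add: algebra_simps)
    then show ?case
      by (simp add: add sum.IH)
  qed
qed

lemma scalar_central:
  fixes p :: "'k::comm_ring_1 free_algebra"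
  shows "Poly_Mapping.single 0 c * p = p * Poly_Mapping.single 0 c"
  by (induction p rule: free_algebra_induct) (simp_all add: mult_single algebra_simps)

theorem mainTheorem4:
  fixes \<alpha> \<beta> :: "'k::{alg_closed_field, field_char_0}"
  assumes "\<alpha> \<noteq> \<beta>"
  shows "trivial_group (Ext1 jordan_plane (S_module \<alpha>) (S_module \<beta>))"
proof -
  let ?R = "jordan_plane :: 'k free_algebra set ring"
  let ?J = "ideal_prod ?R (annihilator ?R (S_module \<beta>)) (annihilator ?R (S_module \<alpha>))"
  define t :: "'k free_algebra" where "t = Poly_Mapping.single 0 (1 / (\<beta> - \<alpha>))"
  define a :: "'k free_algebra" where "a = Poly_Mapping.single 0 \<alpha>"
  define c where "c = t * (var Lx + - a)"
  have eval_c: "eval_at b 0 c = (b - \<alpha>) / (\<beta> - \<alpha>)" for b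
  proof -
    have "- a = Poly_Mapping.single 0 (- \<alpha>)"
      by (simp add: a_def single_uminus)
    then show ?thesis
      by (simp add: c_def t_def eval_at_mult eval_at_add eval_at_var eval_at_single word_eval_def
          zero_word_def)
  qed
  have J: "ideal ?J ?R"
    by (intro ring.ideal_prod_is_ideal jordan_plane_ring left_module.annihilator_ideal
        S_module_left_module)
  have "jordan_class (var Ly) \<otimes>\<^bsub>?R\<^esub> jordan_class (var Ly) \<in> ?J"
    by (intro ideal_prod.prod) (simp_all add: jordan_class_in_annihilator_S eval_at_var)
  then have y2: "jordan_class (var Ly * var Ly) \<in> ?J"
    by (simp add: jordan_class_mult)
  show ?thesis
  proof (rule Ext1_trivial_if_almost_central[OF S_module_left_module S_module_left_module])
    show "jordan_class c \<in> annihilator ?R (S_module \<alpha>)"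
      by (simp add: jordan_class_in_annihilator_S eval_c)
    show "jordan_class c \<odot>\<^bsub>S_module \<beta>\<^esub> v = v" for v
      using assms by (simp add: S_module_smult eval_c)
    fix r assume "r \<in> carrier ?R"
    then obtain p where p: "r = jordan_class p"
      by (auto simp: carrier_jordan_plane)
    have "p * c = t * (p * (var Lx + - a))"
      using scalar_central[of "1 / (\<beta> - \<alpha>)" p] by (simp add: c_def t_def flip: mult.assoc)
    moreover have "p * a = a * p"
      using scalar_central[of \<alpha> p] by (simp add: a_def)
    ultimately have "c * p - p * c = t * (var Lx * p - p * var Lx)"
      by (simp add: c_def algebra_simps)
    then have "jordan_class c \<otimes>\<^bsub>?R\<^esub> r \<ominus>\<^bsub>?R\<^esub> r \<otimes>\<^bsub>?R\<^esub> jordan_class c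
        = jordan_class t \<otimes>\<^bsub>?R\<^esub> jordan_class (var Lx * p - p * var Lx)"
      by (simp add: p jordan_class_mult jordan_class_diff)
    also have "\<dots> \<in> ?J"
      by (rule ideal.I_l_closed[OF J commutator_x_in_ideal[OF J y2]])
        (simp add: carrier_jordan_plane)
    finally show "jordan_class c \<otimes>\<^bsub>?R\<^esub> r \<ominus>\<^bsub>?R\<^esub> r \<otimes>\<^bsub>?R\<^esub> jordan_class c \<in> ?J" .
  qed
qed

end
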